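(* For all real $p \ge 2.81$, we have $b(\ell_p^{406}) \ge 422$.
   Context: For a $d$-dimensional real normed space $\mathbb{M}^d$, its Borsuk number $b(\mathbb{M}^d)$ is the minimum $m \in \mathbb{N}$ such that every bounded non-singleton subset of $\mathbb{M}^d$ can be partitioned into $m$ parts of smaller diameter (each part has diameter strictly smaller than that of the whole set, where diameters are measured in the norm of $\mathbb{M}^d$). For real $p\ge 1$, $\ell_p^d$ denotes $\mathbb{R}^d$ equipped with the norm $\|\mathbf{x}\|_p = \left(\sum_{i=1}^d |x_i|^p\right)^{1/p}$. *)

theory Defs
  imports "HOL-Analysis.Analysis"
begin

text \<open>
  A norm on a real vector space is passed explicitly as a function \<open>N\<close>, because the norm of
  interest depends on a real parameter and so cannot be supplied by a type class instance.
\<close>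

definition norm_bounded :: "('a::real_vector \<Rightarrow> real) \<Rightarrow> 'a set \<Rightarrow> bool" where
  "norm_bounded N S \<longleftrightarrow> (\<exists>B. \<forall>x\<in>S. N x \<le> B)"

text \<open>
  As for the library's \<open>diameter\<close>, the value is meaningful only for bounded sets, and the empty
  set has diameter 0.
\<close>

definition norm_diameter :: "('a::real_vector \<Rightarrow> real) \<Rightarrow> 'a set \<Rightarrow> real" where
  "norm_diameter N S = (if S = {} then 0 else SUP (x, y)\<in>S \<times> S. N (x - y))"

text \<open>
  The blocks of \<open>partition_on\<close> are nonempty, so a partition into \<open>m\<close> parts, some of which may be
  empty, is one with at most \<open>m\<close> blocks. (Requiring exactly \<open>m\<close> nonempty parts would
  exclude two-point sets for every \<open>m > 2\<close>.) The empty set, which is not a singleton either,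
  satisfies the condition trivially through its empty partition.
\<close>

definition borsuk_partitionable :: "('a::real_vector \<Rightarrow> real) \<Rightarrow> nat \<Rightarrow> 'a set \<Rightarrow> bool" where
  "borsuk_partitionable N m S \<longleftrightarrow>
     (\<exists>P. partition_on S P \<and> finite P \<and> card P \<le> m \<and>
          (\<forall>A\<in>P. norm_diameter N A < norm_diameter N S))"

definition borsuk_number :: "('a::real_vector \<Rightarrow> real) \<Rightarrow> nat" where
  "borsuk_number N =
     (LEAST m. \<forall>S. norm_bounded N S \<and> \<not> is_singleton S \<longrightarrow> borsuk_partitionable N m S)"

definition lp_norm :: "real \<Rightarrow> real ^ 'n \<Rightarrow> real" where
  "lp_norm p x = (\<Sum>i\<in>UNIV. \<bar>x $ i\<bar> powr p) powr (1 / p)"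

end

theory Submission
  imports Defs
begin

text \<open>
  Index the coordinates by the \<open>406\<close> two-element subsets of a 29-element set, and send a
  9-element subset \<open>A\<close> to the point with coordinate \<open>1\<close> at the pairs contained in \<open>A\<close>, \<open>-1\<close> at
  the pairs split by \<open>A\<close> and \<open>0\<close> at the pairs disjoint from \<open>A\<close>. With \<open>u = card (A - B)\<close> and
  \<open>Q = 2 powr p\<close>, the \<open>p\<close>-th power of the distance between the points of \<open>A\<close> and \<open>B\<close> is
  \<open>u * (18 * Q + 39 - u * (2 * Q + 1))\<close>, which for \<open>Q > 7\<close> is maximal exactly at \<open>u = 5\<close>, that is
  when \<open>card (A \<inter> B) = 4\<close>; and \<open>2.81\<close> just exceeds \<open>log 2 7\<close>. So a part of smaller diameter
  is a family of 9-sets without intersections of size \<open>4\<close>. By the Frankl--Wilson argument modulo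
  \<open>5\<close> it has at most \<open>29 choose 4\<close> members, and \<open>421 * (29 choose 4) < 29 choose 9\<close>.
\<close>

section \<open>Families of sets with restricted intersections\<close>

text \<open>
  Modulo \<open>q\<close>, the incidence vectors of the members of \<open>F\<close> against the \<open>s\<close>-subsets of \<open>X\<close> are
  orthonormal. Instead of a rank argument, which would need \<open>q\<close> prime, the proof counts
  coefficient vectors: their linear combinations modulo \<open>q\<close> determine them.
\<close>

lemma card_family_le_choose:
  fixes X :: "'a set" and q s :: nat
  assumes "finite X" "F \<subseteq> Pow X" "1 < q"
    and one: "\<And>A. A \<in> F \<Longrightarrow> (card A choose s) mod q = 1"
    and zero: "\<And>A B. A \<in> F \<Longrightarrow> B \<in> F \<Longrightarrow> A \<noteq> B \<Longrightarrow> q dvd (card (A \<inter> B) choose s)"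
  shows "card F \<le> card X choose s"
proof -
  define T where "T = {t. t \<subseteq> X \<and> card t = s}"
  have finF: "finite F" and finT: "finite T"
    using assms(1,2) by (auto simp: T_def intro: finite_subset)
  have cardT: "card T = card X choose s"
    unfolding T_def using assms(1) by (rule n_subsets)
  \<comment> \<open>\<open>g c\<close> is the linear combination modulo \<open>q\<close>, with
    coefficients \<open>c\<close>, of the incidence vectors of the members of
    \<open>F\<close>.\<close>
  define g where "g c = (\<lambda>t\<in>T. (\<Sum>A | A \<in> F \<and> t \<subseteq> A. c A) mod q)" for c :: "'a set \<Rightarrow> nat"
  \<comment> \<open>Pairing \<open>g c\<close> with the incidence vector of \<open>B\<close>
    isolates the coefficient of \<open>B\<close>, by orthonormality; since \<open>c B < q\<close>,
    its residue is \<open>c B\<close> itself.\<close>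
  have recover: "(\<Sum>t | t \<in> T \<and> t \<subseteq> B. g c t) mod q = c B"
    if c: "c \<in> F \<rightarrow>\<^sub>E {..<q}" and B: "B \<in> F" for c B
  proof -
    have "(\<Sum>t | t \<in> T \<and> t \<subseteq> B. g c t) mod q
        = (\<Sum>t | t \<in> T \<and> t \<subseteq> B. (\<Sum>A | A \<in> F \<and> t \<subseteq> A. c A) mod q) mod q"
      by (auto simp: g_def intro!: arg_cong[where f = "\<lambda>x. x mod q"] sum.cong)
    also have "\<dots> = (\<Sum>t | t \<in> T \<and> t \<subseteq> B. \<Sum>A | A \<in> F \<and> t \<subseteq> A. c A) mod q"
      by (rule mod_sum_eq)
    \<comment> \<open>Double counting: \<open>c A\<close> occurs once for every
      \<open>s\<close>-subset common to \<open>A\<close> and \<open>B\<close>.\<close>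
    also have "(\<Sum>t | t \<in> T \<and> t \<subseteq> B. \<Sum>A | A \<in> F \<and> t \<subseteq> A. c A)
        = (\<Sum>A\<in>F. \<Sum>t | t \<in> {t \<in> T. t \<subseteq> B} \<and> t \<subseteq> A. c A)"
      using finF finT by (intro sum.swap_restrict) auto
    also have "\<dots> = (\<Sum>A\<in>F. (card (A \<inter> B) choose s) * c A)"
    proof (rule sum.cong[OF refl])
      fix A assume "A \<in> F"
      then have "finite (A \<inter> B)" "A \<inter> B \<subseteq> X"
        using assms(1,2) by (auto intro: finite_subset)
      then have "card {t \<in> {t \<in> T. t \<subseteq> B}. t \<subseteq> A} = card (A \<inter> B) choose s"
        using n_subsets[of "A \<inter> B" s]
        by (auto simp: T_def intro!: arg_cong[where f = card] simp flip: n_subsets)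
      then show "(\<Sum>t | t \<in> {t \<in> T. t \<subseteq> B} \<and> t \<subseteq> A. c A) = (card (A \<inter> B) choose s) * c A"
        by simp
    qed
    also have "\<dots> = (card B choose s) * c B + (\<Sum>A\<in>F - {B}. (card (A \<inter> B) choose s) * c A)"
      using finF B by (simp add: sum.remove)
    also have "\<dots> mod q = c B"
    proof -
      have "q dvd (\<Sum>A\<in>F - {B}. (card (A \<inter> B) choose s) * c A)"
        using zero B by (intro dvd_sum) auto
      moreover have "((card B choose s) * c B) mod q = c B"
        using one[OF B] c B by (metis PiE_mem lessThan_iff mod_less mod_mult_left_eq mult_1)
      ultimately show ?thesis
        by (metis add.right_neutral dvd_eq_mod_eq_0 mod_add_right_eq)
    qed
    finally show ?thesis .
  qed
  have "inj_on g (F \<rightarrow>\<^sub>E {..<q})"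
  proof (rule inj_onI)
    fix c d assume cd: "c \<in> F \<rightarrow>\<^sub>E {..<q}" "d \<in> F \<rightarrow>\<^sub>E {..<q}" "g c = g d"
    show "c = d"
      using cd(1,2)
    proof (rule PiE_ext)
      fix B assume "B \<in> F"
      then show "c B = d B"
        using recover[OF cd(1)] recover[OF cd(2)] cd(3) by simp
    qed
  qed
  moreover have "g ` (F \<rightarrow>\<^sub>E {..<q}) \<subseteq> T \<rightarrow>\<^sub>E {..<q}"
    using assms(3) by (auto simp: g_def)
  ultimately have "card (F \<rightarrow>\<^sub>E {..<q}) \<le> card (T \<rightarrow>\<^sub>E {..<q})"
    using finT by (intro card_inj_on_le) (auto intro: finite_PiE)
  then have "q ^ card F \<le> q ^ card T"
    using finF finT by (simp add: card_PiE)
  then show ?thesis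
    using assms(3) cardT by simp
qed

section \<open>Finiteness of the Borsuk number\<close>

lemma abs_component_le_lp_norm:
  assumes "p > 0"
  shows "\<bar>x $ i\<bar> \<le> lp_norm p x"
proof -
  have "\<bar>x $ i\<bar> powr p \<le> (\<Sum>i\<in>UNIV. \<bar>x $ i\<bar> powr p)"
    by (rule member_le_sum) auto
  then have "(\<bar>x $ i\<bar> powr p) powr (1 / p) \<le> lp_norm p x"
    unfolding lp_norm_def using assms by (intro powr_mono2) auto
  then show ?thesis
    using assms by (simp add: powr_powr)
qed

text \<open>Together with the coordinate bound above, this crude estimate replaces Minkowski's
  inequality: differences are controlled coordinate by coordinate. It rests on
  \<open>CARD('n) \<le> CARD('n) powr p\<close>.\<close>

lemma lp_norm_le_CARD_mult:
  fixes x :: "real ^ 'n" and M :: real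
  assumes "p \<ge> 1" "\<And>i. \<bar>x $ i\<bar> \<le> M"
  shows "lp_norm p x \<le> CARD('n) * M"
proof -
  have M: "M \<ge> 0"
    using assms(2) abs_ge_zero order_trans by blast
  have "(\<Sum>i\<in>UNIV. \<bar>x $ i\<bar> powr p) \<le> CARD('n) * M powr p"
    using assms by (intro order_trans[OF sum_bounded_above[where K = "M powr p"]] powr_mono2) auto
  also have "\<dots> \<le> CARD('n) powr p * M powr p"
    using powr_mono[of 1 p "real CARD('n)"] assms(1) by (intro mult_right_mono) auto
  also have "\<dots> = (CARD('n) * M) powr p"
    using M by (simp add: powr_mult)
  finally have "lp_norm p x \<le> ((CARD('n) * M) powr p) powr (1 / p)"
    unfolding lp_norm_def using assms(1) by (intro powr_mono2) (auto intro: sum_nonneg)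
  then show ?thesis
    using assms(1) M by (simp add: powr_powr)
qed

lemma norm_diameter_ge:
  assumes "x \<in> S" "y \<in> S" "bdd_above ((\<lambda>(x, y). N (x - y)) ` (S \<times> S))"
  shows "N (x - y) \<le> norm_diameter N S"
proof -
  have "(\<lambda>(x, y). N (x - y)) (x, y) \<le> (SUP (x, y)\<in>S \<times> S. N (x - y))"
    using assms by (intro cSUP_upper) auto
  then show ?thesis
    using assms(1) by (auto simp: norm_diameter_def)
qed

lemma norm_diameter_le:
  assumes "S \<noteq> {}" "\<And>x y. x \<in> S \<Longrightarrow> y \<in> S \<Longrightarrow> N (x - y) \<le> D"
  shows "norm_diameter N S \<le> D"
  using assms by (auto simp: norm_diameter_def intro!: cSUP_least)

lemma lp_norm_bdd_above_differences:
  fixes S :: "(real ^ 'n) set"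
  assumes "p \<ge> 1" "norm_bounded (lp_norm p) S"
  shows "bdd_above ((\<lambda>(x, y). lp_norm p (x - y)) ` (S \<times> S))"
proof -
  obtain B where B: "\<And>x. x \<in> S \<Longrightarrow> lp_norm p x \<le> B"
    using assms(2) by (auto simp: norm_bounded_def)
  have "lp_norm p (x - y) \<le> CARD('n) * (2 * B)" if "x \<in> S" "y \<in> S" for x y
  proof (rule lp_norm_le_CARD_mult[OF assms(1)])
    fix i
    have "\<bar>x $ i\<bar> \<le> B" "\<bar>y $ i\<bar> \<le> B"
      using B[OF that(1)] B[OF that(2)] assms(1)
        abs_component_le_lp_norm[of p x i] abs_component_le_lp_norm[of p y i] by linarith+
    then show "\<bar>(x - y) $ i\<bar> \<le> 2 * B"
      by simp
  qed
  then show ?thesis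
    by (intro bdd_aboveI2) auto
qed

text \<open>
  Without this, the \<open>LEAST\<close> in \<open>borsuk_number\<close> could be a junk value. The cells of a cubical grid
  of mesh \<open>D / (CARD('n) + 1)\<close> have diameter less than \<open>D\<close>.
\<close>

lemma lp_norm_borsuk_partitionable_ex:
  assumes "p \<ge> 1"
  shows "\<exists>m. \<forall>S. norm_bounded (lp_norm p :: real ^ 'n \<Rightarrow> real) S \<and> \<not> is_singleton S
           \<longrightarrow> borsuk_partitionable (lp_norm p) m S"
proof -
  define k where "k = real CARD('n) + 1"
  \<comment> \<open>One \<open>m\<close> must serve all \<open>S\<close>. Centred at a point of
    \<open>S\<close> and scaled by \<open>k / D\<close>, every coordinate lies between
    \<open>- k\<close> and \<open>k\<close>, so the set \<open>T\<close> of possible cells is the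
    same for all \<open>S\<close>.\<close>
  define T where "T = (UNIV :: 'n set) \<rightarrow>\<^sub>E {- \<lceil>k\<rceil> .. \<lceil>k\<rceil>}"
  have finT: "finite T"
    unfolding T_def by (intro finite_PiE) auto
  have "borsuk_partitionable (lp_norm p) (card T) S"
    if bounded: "norm_bounded (lp_norm p) S" and "\<not> is_singleton S" for S :: "(real ^ 'n) set"
  proof (cases "S = {}")
    case True
    then show ?thesis
      by (auto simp: borsuk_partitionable_def partition_on_def intro!: exI[of _ "{}"])
  next
    case False
    then obtain a where a: "a \<in> S"
      by blast
    obtain b where b: "b \<in> S" "b \<noteq> a"
      using a \<open>\<not> is_singleton S\<close> by (metis is_singletonI' empty_iff)
    define D where "D = norm_diameter (lp_norm p) S"
    have le_D: "lp_norm p (x - y) \<le> D" if "x \<in> S" "y \<in> S" for x y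
      unfolding D_def
      using norm_diameter_ge[OF that lp_norm_bdd_above_differences[OF assms bounded]] .
    obtain j where "b $ j \<noteq> a $ j"
      using b(2) by (auto simp: vec_eq_iff)
    then have "0 < \<bar>(b - a) $ j\<bar>"
      by simp
    also have "\<dots> \<le> lp_norm p (b - a)"
      using assms by (intro abs_component_le_lp_norm) auto
    also have "\<dots> \<le> D"
      using a b by (intro le_D)
    finally have D: "D > 0" .
    have k: "k > 0"
      by (simp add: k_def add_pos_nonneg)
    define cell where "cell x = (\<lambda>i. \<lfloor>(x - a) $ i * k / D\<rfloor>)" for x :: "real ^ 'n"
    have cell_T: "cell x \<in> T" if "x \<in> S" for x
    proof -
      have "\<lfloor>(x - a) $ i * k / D\<rfloor> \<in> {- \<lceil>k\<rceil> .. \<lceil>k\<rceil>}" for i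
      proof -
        have "\<bar>(x - a) $ i\<bar> \<le> D"
          using abs_component_le_lp_norm[of p "x - a" i] le_D[OF that a] assms by linarith
        then have "\<bar>(x - a) $ i * k / D\<bar> \<le> k"
          using D k mult_right_mono[of "\<bar>(x - a) $ i\<bar>" D k]
          by (simp add: abs_mult pos_divide_le_eq mult.commute)
        then have "- \<lceil>k\<rceil> \<le> \<lfloor>(x - a) $ i * k / D\<rfloor>" "\<lfloor>(x - a) $ i * k / D\<rfloor> \<le> \<lceil>k\<rceil>"
          by linarith+
        then show ?thesis
          by simp
      qed
      then show ?thesis
        by (auto simp: T_def cell_def)
    qed
    define P where "P = (\<lambda>v. {x \<in> S. cell x = v}) ` cell ` S"
    have sub: "cell ` S \<subseteq> T"
      using cell_T by blast
    have "partition_on S P"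
      by (rule partition_onI) (auto simp: P_def disjnt_def)
    moreover have "finite P"
      using sub finT unfolding P_def by (blast intro: finite_imageI finite_subset)
    moreover have "card P \<le> card T"
      using card_image_le[of "cell ` S"] card_mono[OF finT sub] finite_subset[OF sub finT]
      unfolding P_def by (meson order_trans)
    moreover have "norm_diameter (lp_norm p) A < D" if "A \<in> P" for A
    proof -
      obtain z where z: "z \<in> S" "A = {x \<in> S. cell x = cell z}"
        using \<open>A \<in> P\<close> unfolding P_def by blast
      have "norm_diameter (lp_norm p) A \<le> CARD('n) * (D / k)"
      proof (rule norm_diameter_le)
        fix x y assume "x \<in> A" "y \<in> A"
        then have eq: "cell x = cell y"
          by (simp add: z)
        show "lp_norm p (x - y) \<le> CARD('n) * (D / k)"
        proof (rule lp_norm_le_CARD_mult[OF assms])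
          fix i
          have "\<lfloor>(x - a) $ i * k / D\<rfloor> = \<lfloor>(y - a) $ i * k / D\<rfloor>"
            using fun_cong[OF eq, of i] by (simp add: cell_def)
          then have "\<bar>(x - a) $ i * k / D - (y - a) $ i * k / D\<bar> \<le> 1"
            by linarith
          also have "(x - a) $ i * k / D - (y - a) $ i * k / D = (x - y) $ i * (k / D)"
            by (simp add: algebra_simps diff_divide_distrib)
          finally have "\<bar>(x - y) $ i\<bar> * (k / D) \<le> 1"
            using D k by (simp add: abs_mult)
          then show "\<bar>(x - y) $ i\<bar> \<le> D / k"
            using D k by (simp add: pos_le_divide_eq pos_divide_le_eq)
        qed
      qed (use z in blast)
      \<comment> \<open>Strict because \<open>k\<close> exceeds \<open>CARD('n)\<close> by
        one.\<close>
      also have "\<dots> < D"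
        using D k by (simp add: field_simps) (simp add: k_def)
      finally show ?thesis .
    qed
    ultimately show ?thesis
      unfolding borsuk_partitionable_def D_def by blast
  qed
  then show ?thesis
    by blast
qed

section \<open>The point set\<close>

definition pair_value :: "'a set \<Rightarrow> 'a \<Rightarrow> 'a \<Rightarrow> real" where
  "pair_value A i j = (if i \<in> A \<and> j \<in> A then 1 else if i \<in> A \<or> j \<in> A then -1 else 0)"

lemma sum_symmetric_pairs:
  fixes f :: "nat \<Rightarrow> nat \<Rightarrow> real"
  assumes "\<And>i j. f i j = f j i"
  shows "(\<Sum>i<n. \<Sum>j<n. f i j) = 2 * (\<Sum>i<n. \<Sum>j<i. f i j) + (\<Sum>i<n. f i i)"
proof (induction n)
  case (Suc n)
  have "(\<Sum>i<n. f i n) = (\<Sum>j<n. f n j)"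
    using assms by (intro sum.cong) auto
  with Suc show ?case
    by (simp add: sum.distrib)
qed simp

text \<open>A pair contributes \<open>2 powr p\<close> if one point lies in
  \<open>A \<inter> B\<close> and the other in exactly one of the sets. It contributes 1 if both
  points lie in the same difference, or if one lies in a difference and the other outside
  \<open>A \<union> B\<close>. All other pairs contribute 0.\<close>

lemma sum_pair_value_diff:
  fixes A B :: "nat set"
  assumes "p > 0" "A \<subseteq> {..<n}" "B \<subseteq> {..<n}" "card A = w" "card B = w"
    and u: "card (A - B) = u"
  shows "(\<Sum>i<n. \<Sum>j<i. \<bar>pair_value A i j - pair_value B i j\<bar> powr p)
    = 2 * (real w - u) * u * 2 powr p + u * (real u - 1) + 2 * u * (real n - w - u)"
    (is "?S = _")
proof -
  define f where "f i j = \<bar>pair_value A i j - pair_value B i j\<bar> powr p" for i j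
  define ind where "ind C i = (of_bool (i \<in> C) :: real)" for C and i :: nat
  define a b c d where "a = ind (A \<inter> B)" "b = ind (A - B)" "c = ind (B - A)"
    "d = ind ({..<n} - (A \<union> B))"
  have fin: "finite A" "finite B"
    using assms(2,3) by (auto intro: finite_subset)
  have cards: "card (A \<inter> B) + u = w" "card (B - A) = u" "card (A \<union> B) = w + u"
    using card_Int_Diff[OF fin(1), of B] card_Int_Diff[OF fin(2), of A] card_Un_Int[OF fin]
      assms(4,5) u by (auto simp: Int_commute)
  have sum_ind: "(\<Sum>i<n. ind C i) = card C" if "C \<subseteq> {..<n}" for C
    using that by (simp add: ind_def Int_absorb1)
  have sums: "(\<Sum>i<n. a i) = real w - u" "(\<Sum>i<n. b i) = u" "(\<Sum>i<n. c i) = u"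
    "(\<Sum>i<n. d i) = real n - w - u"
  proof -
    have "A \<union> B \<subseteq> {..<n}"
      using assms(2,3) by blast
    then have "card ({..<n} - (A \<union> B)) + (w + u) = n"
      using cards(3) card_mono[of "{..<n}" "A \<union> B"] by (subst card_Diff_subset) (use fin in auto)
    then show "(\<Sum>i<n. d i) = real n - w - u"
      by (simp add: a_b_c_d_def sum_ind)
    have "A \<inter> B \<subseteq> {..<n}" "A - B \<subseteq> {..<n}" "B - A \<subseteq> {..<n}"
      using assms(2,3) by blast+
    then show "(\<Sum>i<n. a i) = real w - u" "(\<Sum>i<n. b i) = u" "(\<Sum>i<n. c i) = u"
      using cards u by (simp_all add: a_b_c_d_def sum_ind)
  qed
  \<comment> \<open>The right-hand side is bilinear in the indicators, so its double sum factors.\<close>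
  have f: "f i j = 2 powr p * (a i * b j + b i * a j + a i * c j + c i * a j)
      + (b i * b j + c i * c j) + (b i * d j + d i * b j + c i * d j + d i * c j)"
    if "i < n" "j < n" for i j
    using that assms(1) unfolding f_def pair_value_def a_b_c_d_def ind_def
    by (cases "i \<in> A"; cases "i \<in> B"; cases "j \<in> A"; cases "j \<in> B") auto
  have "f i j = f j i" for i j
    by (auto simp: f_def pair_value_def)
  then have "(\<Sum>i<n. \<Sum>j<n. f i j) = 2 * ?S + (\<Sum>i<n. f i i)"
    unfolding f_def by (rule sum_symmetric_pairs)
  \<comment> \<open>The diagonal adds up to \<open>2 * u\<close>; removing it and halving turns the
    \<open>2 * u * u\<close> ordered pairs inside the differences into
    \<open>u * (u - 1)\<close>.\<close>
  also have "(\<Sum>i<n. f i i) = (\<Sum>i<n. b i + c i)"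
    using assms(1) by (intro sum.cong) (auto simp: f_def pair_value_def a_b_c_d_def ind_def)
  also have "(\<Sum>i<n. \<Sum>j<n. f i j) = (\<Sum>i<n. \<Sum>j<n.
      2 powr p * (a i * b j + b i * a j + a i * c j + c i * a j)
      + (b i * b j + c i * c j) + (b i * d j + d i * b j + c i * d j + d i * c j))"
    by (intro sum.cong) (auto simp: f)
  finally show ?thesis
    by (simp add: sum.distrib sums flip: sum_distrib_left sum_distrib_right) (simp add: algebra_simps)
qed

section \<open>Numerical facts about the chosen parameters\<close>

lemma seven_less_two_powr:
  assumes "p \<ge> 2.81"
  shows "7 < 2 powr (p :: real)"
proof -
  \<comment> \<open>Raising to the power 100 clears the denominator of 2.81.\<close>
  have "(7 :: real) ^ 100 < 2 ^ 281"
    by simp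
  also have "\<dots> = 2 powr real 281"
    by (rule powr_realpow[symmetric]) simp
  also have "\<dots> = (2 powr 2.81) ^ 100"
    by (simp only: powr_power) simp
  finally have "7 < 2 powr (2.81 :: real)"
    by (rule power_less_imp_less_base) simp
  also have "\<dots> \<le> 2 powr p"
    using assms by (intro powr_mono) auto
  finally show ?thesis .
qed

text \<open>By Lucas, \<open>t choose 4\<close> is nonzero modulo 5 only if \<open>t\<close> is 4
  modulo 5. Below 9 that leaves 4, the forbidden intersection size; the next such value is 9, the
  size of the sets themselves.\<close>

lemma choose_4_mod_5:
  assumes "t < 9" "t \<noteq> 4"
  shows "5 dvd (t choose 4)"
proof -
  have "t \<in> {0, 1, 2, 3, 5, 6, 7, 8}"
    using assms by auto
  moreover have "\<forall>t\<in>{0, 1, 2, 3, 5, 6, 7, 8 :: nat}. 5 dvd (t choose 4)"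
    by code_simp
  ultimately show ?thesis
    by blast
qed

lemma choose_29_9: "29 choose 9 = (10015005 :: nat)"
  using binomial_fact_lemma[of 9 29] by (simp add: fact_numeral)

lemma choose_29_4: "29 choose 4 = (23751 :: nat)"
  using binomial_fact_lemma[of 4 29] by (simp add: fact_numeral)

section \<open>Counting points against the parts of a partition\<close>

theorem corollary1:
  fixes p :: real
  assumes "p \<ge> 2.81"
  shows "borsuk_number (lp_norm p :: real ^ 406 \<Rightarrow> real) \<ge> 422"
proof (rule ccontr)
  let ?N = "lp_norm p :: real ^ 406 \<Rightarrow> real"
  assume "\<not> ?thesis"
  then have few: "borsuk_number ?N \<le> 421"
    by simp
  define Q where "Q = (2 powr p :: real)"
  have p: "p > 0" "p \<ge> 1" and Q: "Q > 7"
    using assms seven_less_two_powr by (auto simp: Q_def)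
  define I where "I = (SIGMA i:{..<29::nat}. {..<i})"
  \<comment> \<open>Each pair is listed once with its larger element first, and 29 * 28 / 2 =
    406.\<close>
  have "card I = CARD(406)"
    by (simp add: I_def eval_nat_numeral)
  then obtain h where h: "bij_betw h (UNIV :: 406 set) I"
    by (metis I_def finite_SigmaI finite_code finite_lessThan finite_same_card_bij)
  define \<phi> :: "nat set \<Rightarrow> real ^ 406"
    where "\<phi> A = (\<chi> k. pair_value A (fst (h k)) (snd (h k)))" for A
  define \<A> where "\<A> = {A. A \<subseteq> {..<29::nat} \<and> card A = 9}"
  define D where "D u = u * (18 * Q + 39 - u * (2 * Q + 1))" for u :: real
  have norm_\<phi>: "?N (\<phi> A - \<phi> B) = D (card (A - B)) powr (1 / p)"
    if "A \<in> \<A>" "B \<in> \<A>" for A B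
  proof -
    have "(\<Sum>k\<in>UNIV. \<bar>(\<phi> A - \<phi> B) $ k\<bar> powr p)
        = (\<Sum>k\<in>UNIV. (\<lambda>(i, j). \<bar>pair_value A i j - pair_value B i j\<bar> powr p) (h k))"
      by (simp add: \<phi>_def case_prod_unfold)
    also have "\<dots> = (\<Sum>(i, j)\<in>I. \<bar>pair_value A i j - pair_value B i j\<bar> powr p)"
      by (rule sum.reindex_bij_betw[OF h])
    also have "\<dots> = (\<Sum>i<29. \<Sum>j<i. \<bar>pair_value A i j - pair_value B i j\<bar> powr p)"
      unfolding I_def by (simp add: sum.Sigma)
    also have "\<dots> = D (card (A - B))"
      using that p sum_pair_value_diff[of p A 29 B 9 "card (A - B)"]
      by (simp add: \<A>_def D_def Q_def algebra_simps)
    finally show ?thesis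
      by (simp add: lp_norm_def)
  qed
  have card_Int: "card (A \<inter> B) + card (A - B) = 9" if "A \<in> \<A>" for A B
    using that card_Int_Diff[of A B] by (auto simp: \<A>_def intro: finite_subset)
  have D_pos: "D u > 0" if "0 < u" "u \<le> 9" for u
  proof -
    have "u * (2 * Q + 1) \<le> 9 * (2 * Q + 1)"
      using that Q by (intro mult_right_mono) auto
    then show ?thesis
      using that by (auto simp: D_def intro!: mult_pos_pos)
  qed
  have D_nonneg: "D u \<ge> 0" if "0 \<le> u" "u \<le> 9" for u
    using D_pos[of u] that by (cases "u = 0") (auto simp: D_def)
  have D_less: "D (real u) < D 5" if "u \<noteq> 5" for u :: nat
  proof -
    \<comment> \<open>For \<open>u \<le> 4\<close> the second factor is at least 30. For
      \<open>u \<ge> 6\<close> it is at most \<open>28 - 4 * Q\<close>, which is where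
      \<open>Q > 7\<close> enters.\<close>
    have eq: "D 5 - D u = (5 - real u) * (18 * Q + 39 - (5 + u) * (2 * Q + 1))"
      by (simp add: D_def algebra_simps)
    have "D 5 - D u > 0"
    proof (cases "u < 5")
      case True
      then have "(5 + real u) * (2 * Q + 1) \<le> 9 * (2 * Q + 1)"
        using Q by (intro mult_right_mono) auto
      then show ?thesis
        unfolding eq using True by (intro mult_pos_pos) auto
    next
      case False
      then have "(5 + real u) * (2 * Q + 1) \<ge> 11 * (2 * Q + 1)"
        using Q that by (intro mult_right_mono) auto
      then show ?thesis
        unfolding eq using False that Q by (intro mult_neg_neg) auto
    qed
    then show ?thesis
      by simp
  qed
  have norm_le: "?N (\<phi> A - \<phi> B) \<le> D 5 powr (1 / p)" if "A \<in> \<A>" "B \<in> \<A>" for A B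
  proof -
    have "D (card (A - B)) \<ge> 0"
      using card_Int[OF that(1), of B] by (intro D_nonneg) auto
    moreover have "D (card (A - B)) \<le> D 5"
      using D_less[of "card (A - B)"] by (cases "card (A - B) = 5") auto
    ultimately show ?thesis
      using p by (simp add: norm_\<phi>[OF that] powr_mono2)
  qed
  have inj: "inj_on \<phi> \<A>"
  proof (rule inj_onI)
    fix A B assume AB: "A \<in> \<A>" "B \<in> \<A>" "\<phi> A = \<phi> B"
    have "?N 0 = 0"
      by (simp add: lp_norm_def)
    then have "D (card (A - B)) = 0"
      using norm_\<phi>[OF AB(1,2)] AB(3) by simp
    then have "card (A - B) = 0"
      using D_pos[of "card (A - B)"] card_Int[OF AB(1), of B] by fastforce
    moreover have "finite A" "finite B"
      using AB by (auto simp: \<A>_def intro: finite_subset)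
    ultimately show "A = B"
      using AB by (intro card_subset_eq) (auto simp: \<A>_def)
  qed
  define S where "S = \<phi> ` \<A>"
  have "card \<A> = 29 choose 9"
    unfolding \<A>_def by (simp only: n_subsets finite_lessThan card_lessThan)
  also have "\<dots> = 10015005"
    by (fact choose_29_9)
  finally have card_S: "card S = 10015005"
    unfolding S_def by (simp add: card_image[OF inj])
  then have S: "finite S" "S \<noteq> {}" "\<not> is_singleton S"
    by (auto simp: is_singleton_altdef intro: card_ge_0_finite)
  have bounded: "norm_bounded ?N S"
    using S(1) unfolding norm_bounded_def by (intro exI[of _ "Max (?N ` S)"]) auto
  have diam_S: "norm_diameter ?N S \<le> D 5 powr (1 / p)"
    using S(2) norm_le by (intro norm_diameter_le) (auto simp: S_def)
  have "borsuk_partitionable ?N (borsuk_number ?N) S"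
    using LeastI_ex[OF lp_norm_borsuk_partitionable_ex[OF p(2)]] bounded S(3)
    unfolding borsuk_number_def by blast
  then obtain P where P: "partition_on S P" "finite P" "card P \<le> borsuk_number ?N"
    "\<And>C. C \<in> P \<Longrightarrow> norm_diameter ?N C < norm_diameter ?N S"
    by (auto simp: borsuk_partitionable_def)
  have card_part: "card C \<le> 23751" if "C \<in> P" for C
  proof -
    define F where "F = {A \<in> \<A>. \<phi> A \<in> C}"
    have "C \<subseteq> S"
      using P(1) that by (auto simp: partition_on_def)
    then have C: "C = \<phi> ` F" and "finite C"
      using S(1) by (auto simp: F_def S_def intro: finite_subset)
    \<comment> \<open>Two members meeting in 4 points would give \<open>C\<close> a diameter of at
      least \<open>D 5 powr (1 / p)\<close>, which already bounds the diameter of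
      \<open>S\<close>.\<close>
    have avoid: "card (A \<inter> B) \<noteq> 4" if "A \<in> F" "B \<in> F" for A B
    proof
      assume "card (A \<inter> B) = 4"
      then have "card (A - B) = 5"
        using card_Int[of A B] that by (auto simp: F_def)
      then have "D 5 powr (1 / p) = ?N (\<phi> A - \<phi> B)"
        using norm_\<phi>[of A B] that by (auto simp: F_def)
      also have "\<dots> \<le> norm_diameter ?N C"
        using that \<open>finite C\<close> by (intro norm_diameter_ge) (auto simp: F_def)
      also have "\<dots> < norm_diameter ?N S"
        using P(4) \<open>C \<in> P\<close> by blast
      finally show False
        using diam_S by simp
    qed
    have "card F \<le> card {..<29::nat} choose 4"
    proof (rule card_family_le_choose[where q = 5])
      fix A assume "A \<in> F"
      then have "card A = 9"
        by (simp add: F_def \<A>_def)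
      moreover have "(9 choose 4) mod 5 = (1 :: nat)"
        by code_simp
      ultimately show "(card A choose 4) mod 5 = 1"
        by (simp only:)
    next
      fix A B assume AB: "A \<in> F" "B \<in> F" "A \<noteq> B"
      then have "finite A" "finite B" "card A = 9" "card B = 9"
        by (auto simp: F_def \<A>_def intro: finite_subset)
      then have "A \<inter> B \<subset> A"
        using AB(3) card_subset_eq[of B A] by auto
      then have "card (A \<inter> B) < 9"
        using psubset_card_mono[OF \<open>finite A\<close>] \<open>card A = 9\<close> by metis
      then show "5 dvd (card (A \<inter> B) choose 4)"
        using avoid AB by (intro choose_4_mod_5) auto
    qed (auto simp: F_def \<A>_def)
    also have "\<dots> = 29 choose 4"
      by (simp only: card_lessThan)
    also have "\<dots> = 23751"
      by (fact choose_29_4)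
    finally show ?thesis
      using card_image_le[of F \<phi>] \<open>C = \<phi> ` F\<close> inj
      by (metis (no_types, lifting) F_def card_image inj_on_subset mem_Collect_eq subsetI)
  qed
  have "card S \<le> (\<Sum>C\<in>P. card C)"
    using P(1) card_Union_le_sum_card[of P] by (simp add: partition_on_def)
  also have "\<dots> \<le> card P * 23751"
    using card_part sum_bounded_above[of P card 23751] by simp
  \<comment> \<open>The product is 9999171, just below the 10015005 points of
    \<open>S\<close>.\<close>
  also have "\<dots> \<le> 421 * 23751"
    using P(3) few by (intro mult_right_mono) auto
  finally show False
    using card_S by simp
qed

end
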